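(* Let $\mathcal{R}$ be a symmetric association scheme. If there is at most one non-trivial relation in $\mathcal{R}$ that is neither strongly regular of Latin square type nor strongly regular of negative Latin square type, then $\mathcal{R}$ is amorphic.
   Context: A symmetric $d$-class association scheme on a finite set $X$ with $|X|=v$ is a set $\mathcal{R}=\{A_0,\dots,A_d\}$ of $X\times X$ $01$-matrices with $A_0=I$, $\sum_iA_i=J$, $A_i^\top=A_i$, $A_iA_j=\sum_h p_{ij}^hA_h$; $A_1,\dots,A_d$ are the non-trivial relations, each regarded as the adjacency matrix of a graph on $X$. $\mathcal{R}$ is amorphic if for every partition of $\{0,\dots,d\}$ having $\{0\}$ as a part, the sums of the $A_l$ over the parts form an association scheme. A strongly regular graph on $v$ vertices with valency $k$ is of Latin square type if $v=n^2$, $k=t(n-1)$ and its restricted eigenvalues (eigenvalues on eigenvectors orthogonal to the all-ones vector) are $n-t$ and $-t$ for some positive integers $n,t$; it is of negative Latin square type if the same holds with $n,t$ negative integers. *)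

theory Defs
  imports "HOL-Analysis.Analysis" "HOL-Library.Disjoint_Sets"
begin

definition all_ones_mat :: "real ^ 'x ^ 'x"
  where "all_ones_mat = (\<chi> x y. 1)"

definition zero_one_mat :: "real ^ 'x ^ 'x \<Rightarrow> bool"
  where "zero_one_mat M \<longleftrightarrow> (\<forall>x y. M $ x $ y = 0 \<or> M $ x $ y = 1)"

text \<open>
  A symmetric association scheme on the finite type \<^typ>\<open>'x\<close>, as a family of matrices \<open>A\<close>
  over a finite index set \<open>I\<close> in which \<open>z\<close> is the index of the identity relation. The index set
  is arbitrary so that the matrices obtained by merging relations can be indexed by the parts of
  a partition. Injectivity says that the family is a set of \<open>card I\<close> matrices.
\<close>

definition symmetric_association_scheme ::
    "'i set \<Rightarrow> 'i \<Rightarrow> ('i \<Rightarrow> real ^ 'x::finite ^ 'x) \<Rightarrow> bool"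
  where "symmetric_association_scheme I z A \<longleftrightarrow>
    finite I \<and> z \<in> I \<and> inj_on A I \<and>
    (\<forall>i\<in>I. zero_one_mat (A i)) \<and>
    A z = mat 1 \<and>
    (\<Sum>i\<in>I. A i) = all_ones_mat \<and>
    (\<forall>i\<in>I. transpose (A i) = A i) \<and>
    (\<exists>p :: 'i \<Rightarrow> 'i \<Rightarrow> 'i \<Rightarrow> real.
       \<forall>i\<in>I. \<forall>j\<in>I. A i ** A j = (\<Sum>h\<in>I. p i j h *\<^sub>R A h))"

definition amorphic :: "nat \<Rightarrow> (nat \<Rightarrow> real ^ 'x::finite ^ 'x) \<Rightarrow> bool"
  where "amorphic d A \<longleftrightarrow>
    (\<forall>P. partition_on {0..d} P \<and> {0} \<in> P \<longrightarrow>
       symmetric_association_scheme P {0} (\<lambda>S. \<Sum>l\<in>S. A l))"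

text \<open>
  \<open>M\<close> is the adjacency matrix of a strongly regular graph with valency \<open>k\<close>, with \<open>a\<close> common
  neighbours for adjacent and \<open>c\<close> for distinct non-adjacent vertices. As usual, edgeless and
  complete graphs are excluded; disconnected graphs and their complements are not.
\<close>

definition strongly_regular :: "real ^ 'x::finite ^ 'x \<Rightarrow> nat \<Rightarrow> nat \<Rightarrow> nat \<Rightarrow> bool"
  where "strongly_regular M k a c \<longleftrightarrow>
    zero_one_mat M \<and> transpose M = M \<and> (\<forall>x. M $ x $ x = 0) \<and>
    M \<noteq> 0 \<and> M \<noteq> all_ones_mat - mat 1 \<and>
    (\<forall>x. card {y. M $ x $ y = 1} = k) \<and>
    (\<forall>x y. M $ x $ y = 1 \<longrightarrow> card {w. M $ x $ w = 1 \<and> M $ y $ w = 1} = a) \<and>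
    (\<forall>x y. x \<noteq> y \<and> M $ x $ y = 0 \<longrightarrow> card {w. M $ x $ w = 1 \<and> M $ y $ w = 1} = c)"

definition restricted_eigenvalues :: "real ^ 'x::finite ^ 'x \<Rightarrow> real set"
  where "restricted_eigenvalues M =
    {\<theta>. \<exists>w. w \<noteq> 0 \<and> orthogonal w (\<chi> x. 1) \<and> M *v w = \<theta> *\<^sub>R w}"

definition srg_with_type_params :: "real ^ 'x::finite ^ 'x \<Rightarrow> int \<Rightarrow> int \<Rightarrow> bool"
  where "srg_with_type_params M n t \<longleftrightarrow>
    int CARD('x) = n\<^sup>2 \<and>
    (\<exists>k a c. strongly_regular M k a c \<and> int k = t * (n - 1)) \<and>
    restricted_eigenvalues M = {of_int (n - t), of_int (- t)}"

definition srg_latin_square_type :: "real ^ 'x::finite ^ 'x \<Rightarrow> bool"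
  where "srg_latin_square_type M \<longleftrightarrow> (\<exists>n t. n > 0 \<and> t > 0 \<and> srg_with_type_params M n t)"

definition srg_negative_latin_square_type :: "real ^ 'x::finite ^ 'x \<Rightarrow> bool"
  where "srg_negative_latin_square_type M \<longleftrightarrow>
    (\<exists>n t. n < 0 \<and> t < 0 \<and> srg_with_type_params M n t)"

end

theory Submission imports Defs begin

text \<open>
  Write \<open>v = m\<^sup>2\<close>, where the sign of \<open>m\<close> distinguishes the two types. A relation of (negative)
  Latin square type is \<open>A = m F - t I + (t / m) J\<close> with \<open>F\<close> an orthogonal projection of rank
  \<open>t (m - 1)\<close> and \<open>F J = 0\<close>. As \<open>tr (A A') = 0\<close> for different relations, \<open>tr (F F') = 0\<close> and hence
  \<open>F F' = 0\<close> if both have the same type, whereas \<open>tr (F F') = - 2 t t' \<noteq> 0\<close> for opposite types.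

  If both types occurred among all nonzero relations but one, there would be more joint eigenspaces of the
  projections than the dimension of the scheme allows, unless one of the types is represented by a
  single graph of conference type (\<open>2 t = m + 1\<close>); but such a graph is of both types. So all the
  projections can be taken for one sign of \<open>m\<close>, they are pairwise orthogonal, and the remaining
  relation belongs in the same way to the complementary projection \<open>I - J / v - (\<Sum> F)\<close>. Sums of
  pairwise orthogonal projections multiply to such sums again, so every fusion is a scheme.
\<close>

section \<open>Square matrices\<close>

lemma trace_mat_1: "trace (mat 1 :: real^'x^'x) = real CARD('x::finite)"
  by (simp add: trace_I)

text \<open>One interpretation then supplies distributivity over sums, differences and scalars, so
  that most of the later matrix algebra is rewriting with \<open>matrix_mult_simps\<close>.\<close>

lemma bounded_bilinear_matrix_mult:
  "bounded_bilinear ((**) :: real^'x^'x \<Rightarrow> real^'x^'x \<Rightarrow> real^'x::finite^'x)"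
proof -
  have "bilinear ((**) :: real^'x^'x \<Rightarrow> real^'x^'x \<Rightarrow> real^'x::finite^'x)"
    unfolding bilinear_def linear_iff
    by (auto simp: vec_eq_iff matrix_matrix_mult_def sum.distrib sum_distrib_left algebra_simps)
  then show ?thesis
    by (simp add: bilinear_conv_bounded_bilinear)
qed

interpretation matrix_mult: bounded_bilinear
  "(**) :: real^'x^'x \<Rightarrow> real^'x^'x \<Rightarrow> real^'x::finite^'x"
  by (rule bounded_bilinear_matrix_mult)

lemmas matrix_mult_simps = matrix_mult.add_left matrix_mult.add_right matrix_mult.diff_left
  matrix_mult.diff_right matrix_mult.scaleR_left matrix_mult.scaleR_right
  matrix_mult.zero_left matrix_mult.zero_right matrix_mul_lid matrix_mul_rid

lemma linear_trace: "linear (trace :: real^'x^'x::finite \<Rightarrow> real)"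
  by (auto simp: linear_iff trace_def sum.distrib sum_distrib_left)

lemma linear_transpose: "linear (transpose :: real^'x^'x \<Rightarrow> real^'x::finite^'x)"
  by (auto simp: linear_iff transpose_def vec_eq_iff)

lemmas trace_simps = linear_add[OF linear_trace] linear_diff[OF linear_trace]
  linear_cmul[OF linear_trace] linear_sum[OF linear_trace] linear_0[OF linear_trace]

lemmas transpose_simps = linear_add[OF linear_transpose] linear_diff[OF linear_transpose]
  linear_cmul[OF linear_transpose] linear_sum[OF linear_transpose] transpose_mat

lemma all_ones_nth [simp]: "all_ones_mat $ x $ y = 1"
  by (simp add: all_ones_mat_def)

lemma transpose_all_ones [simp]: "transpose all_ones_mat = all_ones_mat"
  by (simp add: vec_eq_iff transpose_def)

lemma trace_all_ones: "trace (all_ones_mat :: real^'x^'x) = real CARD('x::finite)"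
  by (simp add: trace_def)

lemma mult_all_ones_iff:
  fixes M :: "real^'x^'x::finite"
  shows "M ** all_ones_mat = k *\<^sub>R all_ones_mat \<longleftrightarrow> (\<forall>x. (\<Sum>y\<in>UNIV. M $ x $ y) = k)"
  by (simp add: vec_eq_iff matrix_matrix_mult_def)

lemma all_ones_mult_all_ones:
  "all_ones_mat ** all_ones_mat = real CARD('x) *\<^sub>R (all_ones_mat :: real^'x^'x::finite)"
  by (simp add: mult_all_ones_iff)

lemma symmetric_matrix_nth:
  assumes "transpose M = M" shows "M $ x $ y = M $ y $ x"
  using assms by (metis transpose_def vec_lambda_beta)

lemma symmetric_mult_transpose:
  fixes M N :: "real^'x^'x::finite"
  assumes "transpose M = M" "transpose N = N"
  shows "transpose (M ** N) = N ** M"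
  by (simp add: assms matrix_transpose_mul)

lemma trace_mult_symmetric:
  fixes M N :: "real^'x^'x::finite"
  assumes "transpose N = N"
  shows "trace (M ** N) = (\<Sum>x\<in>UNIV. \<Sum>y\<in>UNIV. M $ x $ y * N $ x $ y)"
  unfolding trace_def matrix_matrix_mult_def
  by (simp add: symmetric_matrix_nth[OF assms])

text \<open>For a symmetric idempotent, \<open>trace P = trace (P ** P)\<close> is the sum of the
  squares of its entries.\<close>

lemma symmetric_idem_eq_0:
  fixes P :: "real^'x^'x::finite"
  assumes "transpose P = P" "P ** P = P" "trace P = 0"
  shows "P = 0"
proof -
  have "(\<Sum>x\<in>UNIV. \<Sum>y\<in>UNIV. (P $ x $ y)\<^sup>2) = 0"
    using trace_mult_symmetric[of P P] assms by (simp add: power2_eq_square)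
  then show ?thesis
    by (simp add: sum_nonneg_eq_0_iff sum_nonneg vec_eq_iff)
qed

section \<open>Graphs of Latin square type as projections\<close>

text \<open>
  The projection onto the eigenspace of \<open>m - t\<close> orthogonal to the all-ones vector.
\<close>

definition latin_idem :: "real \<Rightarrow> real \<Rightarrow> real^'x^'x \<Rightarrow> real^'x^'x::finite"
  where "latin_idem m t M = (1/m) *\<^sub>R M + (t/m) *\<^sub>R mat 1 - (t/m\<^sup>2) *\<^sub>R all_ones_mat"

text \<open>Keeps only what linear algebra needs of the graph, with real \<open>m\<close> of either
  sign, so that both types are handled together. Idempotence says that every eigenvalue on vectors
  orthogonal to the all-ones vector is \<open>m - t\<close> or \<open>- t\<close>.\<close>

definition latin_like :: "real \<Rightarrow> real \<Rightarrow> real^'x^'x::finite \<Rightarrow> bool"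
  where "latin_like m t M \<longleftrightarrow> m\<^sup>2 = real CARD('x) \<and> transpose M = M \<and> trace M = 0 \<and>
    M ** all_ones_mat = (t * (m - 1)) *\<^sub>R all_ones_mat \<and>
    latin_idem m t M ** latin_idem m t M = latin_idem m t M"

lemma latin_like_nonzero:
  assumes "latin_like m t (M :: real^'x^'x::finite)" shows "m \<noteq> 0"
  using assms by (auto simp: latin_like_def)

lemma latin_idem_expand:
  assumes "m \<noteq> 0"
  shows "M = m *\<^sub>R latin_idem m t M - t *\<^sub>R mat 1 + (t/m) *\<^sub>R all_ones_mat"
  using assms by (simp add: latin_idem_def algebra_simps power2_eq_square)

lemma latin_like_idem:
  fixes M :: "real^'x^'x::finite"
  assumes "latin_like m t M"
  defines "F \<equiv> latin_idem m t M"
  shows "transpose F = F" "F ** F = F" "F ** all_ones_mat = 0" "all_ones_mat ** F = 0"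
    "trace F = t * (m - 1)"
proof -
  have m: "m \<noteq> 0" and v: "real CARD('x) = m\<^sup>2" and MJ: "M ** all_ones_mat = (t * (m - 1)) *\<^sub>R all_ones_mat"
    and tr: "trace M = 0"
    using assms latin_like_nonzero by (auto simp: latin_like_def)
  show sym: "transpose F = F" and "F ** F = F"
    using assms by (auto simp: latin_like_def latin_idem_def transpose_simps)
  show FJ: "F ** all_ones_mat = 0"
    using m unfolding F_def latin_idem_def
    by (simp add: matrix_mult_simps MJ all_ones_mult_all_ones v)
      (simp add: vec_eq_iff field_simps)
  show "all_ones_mat ** F = 0"
    using symmetric_mult_transpose[OF sym transpose_all_ones] FJ
    by (simp add: linear_0[OF linear_transpose])
  show "trace F = t * (m - 1)"
    using m unfolding F_def latin_idem_def
    by (simp add: trace_simps tr trace_mat_1 trace_all_ones v) (simp add: field_simps power2_eq_square)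
qed

section \<open>Eigenvalues of strongly regular graphs\<close>

lemma strongly_regular_square:
  fixes M :: "real^'x^'x::finite"
  assumes "strongly_regular M k a c"
  shows "M ** M = (real a - real c) *\<^sub>R M + (real k - real c) *\<^sub>R mat 1 + real c *\<^sub>R all_ones_mat"
proof -
  have zo: "M $ x $ y = 0 \<or> M $ x $ y = 1" and sym: "transpose M = M" and d: "M $ x $ x = 0" for x y
    using assms by (auto simp: strongly_regular_def zero_one_mat_def)
  have "(M ** M) $ x $ y = real (card {w. M $ x $ w = 1 \<and> M $ y $ w = 1})" for x y
  proof -
    have "(M ** M) $ x $ y = (\<Sum>w\<in>UNIV. if M $ x $ w = 1 \<and> M $ y $ w = 1 then 1 else 0)"
      unfolding matrix_matrix_mult_def vec_lambda_beta
    proof (rule sum.cong)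
      fix w
      show "M $ x $ w * M $ w $ y = (if M $ x $ w = 1 \<and> M $ y $ w = 1 then 1 else 0)"
        using zo[of x w] zo[of y w] by (auto simp: symmetric_matrix_nth[OF sym, of w y])
    qed simp
    then show ?thesis
      by (simp add: sum.If_cases)
  qed
  moreover have "real (card {w. M $ x $ w = 1 \<and> M $ y $ w = 1}) =
      (real a - real c) * M $ x $ y + (real k - real c) * (if x = y then 1 else 0) + real c" for x y
    using assms zo[of x y] d[of x] by (cases "x = y") (auto simp: strongly_regular_def)
  ultimately show ?thesis
    by (simp add: vec_eq_iff mat_def)
qed

lemma strongly_regular_mult_all_ones:
  fixes M :: "real^'x^'x::finite"
  assumes "strongly_regular M k a c"
  shows "M ** all_ones_mat = real k *\<^sub>R all_ones_mat"
proof -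
  have "(\<Sum>y\<in>UNIV. M $ x $ y) = real k" for x
  proof -
    have "M $ x $ y = 0 \<or> M $ x $ y = 1" for y
      using assms by (auto simp: strongly_regular_def zero_one_mat_def)
    then have "(\<Sum>y\<in>UNIV. M $ x $ y) = (\<Sum>y\<in>UNIV. if M $ x $ y = 1 then 1 else 0)"
      by (intro sum.cong) (auto split: if_splits)
    also have "\<dots> = real (card {y. M $ x $ y = 1})"
      by (simp add: sum.If_cases)
    finally show ?thesis
      using assms by (simp add: strongly_regular_def)
  qed
  then show ?thesis
    by (simp add: mult_all_ones_iff)
qed

lemma strongly_regular_eigenvalue:
  fixes M :: "real^'x^'x::finite"
  assumes "strongly_regular M k a c" "\<theta> \<in> restricted_eigenvalues M"
  shows "\<theta>\<^sup>2 = (real a - real c) * \<theta> + (real k - real c)"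
proof -
  obtain w where w: "w \<noteq> 0" "orthogonal w (\<chi> x. 1)" "M *v w = \<theta> *\<^sub>R w"
    using assms(2) by (auto simp: restricted_eigenvalues_def)
  have "all_ones_mat *v w = 0"
    using w(2) by (simp add: vec_eq_iff matrix_vector_mult_def orthogonal_def inner_vec_def)
  have "(M ** M) *v w = (\<theta>\<^sup>2) *\<^sub>R w"
    by (simp add: w(3) power2_eq_square matrix_vector_mult_scaleR flip: matrix_vector_mul_assoc)
  moreover have "(M ** M) *v w = ((real a - real c) * \<theta> + (real k - real c)) *\<^sub>R w"
    unfolding strongly_regular_square[OF assms(1)]
    by (simp add: w(3) \<open>all_ones_mat *v w = 0\<close> matrix_vector_mult_add_rdistrib
        scaleR_matrix_vector_assoc[symmetric] scaleR_add_left)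
  ultimately show ?thesis
    using w(1) by (metis scaleR_cancel_right)
qed

text \<open>As \<open>m\<close> is nonzero, \<open>m - s\<close> and \<open>- s\<close> are the two
  distinct roots of the quadratic for restricted eigenvalues. They determine \<open>a\<close>,
  \<open>c\<close> and hence \<open>M ** M\<close> as expressions in \<open>m\<close> and
  \<open>s\<close>.\<close>

lemma srg_with_type_params_latin_like:
  fixes M :: "real^'x^'x::finite"
  assumes "srg_with_type_params M n t"
  shows "latin_like (of_int n) (of_int t) M"
proof -
  define m s where "m = real_of_int n" "s = real_of_int t"
  obtain k a c where srg: "strongly_regular M k a c" and "int k = t * (n - 1)"
    and ev: "restricted_eigenvalues M = {m - s, - s}" and "int CARD('x) = n\<^sup>2"
    using assms by (auto simp: srg_with_type_params_def m_s_def)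
  then have k: "real k = s * (m - 1)" and v: "m\<^sup>2 = real CARD('x)"
    unfolding m_s_def
    by (metis of_int_diff of_int_mult of_int_1 of_int_of_nat_eq)
      (metis \<open>int CARD('x) = n\<^sup>2\<close> of_int_power of_int_of_nat_eq)
  then have m: "m \<noteq> 0" by auto
  have 1: "(m - s)\<^sup>2 = (real a - real c) * (m - s) + (real k - real c)"
    and 2: "(- s)\<^sup>2 = (real a - real c) * (- s) + (real k - real c)"
    by (rule strongly_regular_eigenvalue[OF srg]; simp add: ev)+
  have "m * (real a - real c) = m * (m - 2 * s)"
    using 1 2 by (simp add: power2_eq_square algebra_simps)
  then have ac: "real a - real c = m - 2 * s"
    using m by simp
  then have kc: "real k - real c = s * (m - s)"
    using 2 unfolding ac by (simp add: power2_eq_square algebra_simps)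
  then have c: "real c = s\<^sup>2 - s"
    using k by (simp add: power2_eq_square algebra_simps)
  have sym: "transpose M = M" and tr: "trace M = 0"
    using srg by (auto simp: strongly_regular_def trace_def)
  have MJ: "M ** all_ones_mat = (s * (m - 1)) *\<^sub>R all_ones_mat"
    using strongly_regular_mult_all_ones[OF srg] k by simp
  then have JM: "all_ones_mat ** M = (s * (m - 1)) *\<^sub>R all_ones_mat"
    using symmetric_mult_transpose[OF sym transpose_all_ones] by (simp add: transpose_simps)
  have sq: "M ** M = (m - 2 * s) *\<^sub>R M + (s * (m - s)) *\<^sub>R mat 1 + (s\<^sup>2 - s) *\<^sub>R all_ones_mat"
    unfolding ac[symmetric] kc[symmetric] c[symmetric] by (rule strongly_regular_square[OF srg])
  \<comment> \<open>Expanding the square with arbitrary coefficients delays the fractions of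
    \<open>latin_idem\<close> to the final comparison.\<close>
  have prod: "((r *\<^sub>R M + q *\<^sub>R mat 1 - w *\<^sub>R all_ones_mat) **
        (r *\<^sub>R M + q *\<^sub>R mat 1 - w *\<^sub>R all_ones_mat)) $ x $ y =
      r * r * (M ** M) $ x $ y + 2 * r * q * M $ x $ y + q * q * mat 1 $ x $ y
      - 2 * w * (r * (s * (m - 1)) + q) + w * w * (m * m)" for r q w x y
    by (simp add: matrix_mult_simps MJ JM all_ones_mult_all_ones flip: v)
      (simp add: algebra_simps power2_eq_square)
  have "(latin_idem m s M ** latin_idem m s M) $ x $ y = latin_idem m s M $ x $ y" for x y
    using m unfolding latin_idem_def prod sq by (simp add: field_simps power2_eq_square)
  then have "latin_idem m s M ** latin_idem m s M = latin_idem m s M"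
    by (simp add: vec_eq_iff)
  then show ?thesis
    using v sym tr MJ by (simp add: latin_like_def m_s_def)
qed

text \<open>
  The hypothesis singles out the graphs of conference type; these exchange their two eigenspaces.
\<close>

lemma latin_like_switch:
  fixes M :: "real^'x^'x::finite"
  assumes "latin_like m t M" "2 * t = m + 1"
  shows "latin_like (- m) (t - m) M"
proof -
  define F where "F = latin_idem m t M"
  note F = latin_like_idem[OF assms(1), folded F_def]
  have m: "m \<noteq> 0" and v: "m\<^sup>2 = real CARD('x)"
    using assms latin_like_nonzero by (auto simp: latin_like_def)
  have t: "t = (m + 1) / 2"
    using assms(2) by simp
  \<comment> \<open>The new projection is the complement of \<open>F\<close> in the space orthogonal
    to the all-ones vector. The coefficients of \<open>all_ones_mat\<close> here and the valencies
    below agree because \<open>2 * t = m + 1\<close>.\<close>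
  have eq: "latin_idem (- m) (t - m) M = mat 1 - (1/m\<^sup>2) *\<^sub>R all_ones_mat - F"
    using m unfolding F_def latin_idem_def t
    by (simp add: vec_eq_iff field_simps power2_eq_square)
  have "(mat 1 - (1/m\<^sup>2) *\<^sub>R all_ones_mat - F) ** (mat 1 - (1/m\<^sup>2) *\<^sub>R all_ones_mat - F)
      = mat 1 - (1/m\<^sup>2) *\<^sub>R all_ones_mat - F"
    using m by (simp add: matrix_mult_simps F all_ones_mult_all_ones flip: v)
  moreover have "t * (m - 1) = (t - m) * (- m - 1)"
    unfolding t by (simp add: field_simps)
  ultimately show ?thesis
    using assms(1) eq by (simp add: latin_like_def)
qed

text \<open>Writing both factors of \<open>M ** N\<close> through their projections turns the
  vanishing trace into a linear equation for the trace of the product of the projections. As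
  \<open>m\<^sup>2 = n\<^sup>2\<close>, that trace is 0 for \<open>n = m\<close> and
  \<open>- 2 * t * u\<close> for \<open>n = - m\<close>.\<close>

lemma latin_like_trace_mult:
  fixes M N :: "real^'x^'x::finite"
  assumes M: "latin_like m t M" and N: "latin_like n u N" and MN: "trace (M ** N) = 0"
  shows "m * trace (latin_idem m t M ** latin_idem n u N) = t * u * (n - m)"
proof -
  define F E where "F = latin_idem m t M" and "E = latin_idem n u N"
  note F = latin_like_idem[OF M, folded F_def] and E = latin_like_idem[OF N, folded E_def]
  have m: "m \<noteq> 0" "n \<noteq> 0" and v: "real CARD('x) = m\<^sup>2" and mn: "m\<^sup>2 = n\<^sup>2"
    using assms latin_like_nonzero by (auto simp: latin_like_def)
  have "M ** N = (m *\<^sub>R F - t *\<^sub>R mat 1 + (t/m) *\<^sub>R all_ones_mat) **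
      (n *\<^sub>R E - u *\<^sub>R mat 1 + (u/n) *\<^sub>R all_ones_mat)"
    using latin_idem_expand m unfolding F_def E_def by metis
  then have "0 = trace \<dots>"
    using MN by simp
  also have "\<dots> = m * n * trace (F ** E) - m * u * trace F - t * n * trace E + t * u * m\<^sup>2
      - t * u / n * m\<^sup>2 - t * u / m * m\<^sup>2 + t * u / (m * n) * (m\<^sup>2 * m\<^sup>2)"
    using m by (simp add: matrix_mult_simps trace_simps F E trace_mat_1 trace_all_ones
        all_ones_mult_all_ones v algebra_simps)
  also have "t * u / (m * n) * (m\<^sup>2 * m\<^sup>2) = t * u * m * n"
    using m mn by (simp add: field_simps power2_eq_square)
  also have "t * u / n * m\<^sup>2 = t * u * n"
    using m unfolding mn by (simp add: power2_eq_square)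
  also have "t * u / m * m\<^sup>2 = t * u * m"
    using m by (simp add: power2_eq_square)
  finally have "n * (m * trace (F ** E)) = n * (t * u * (n - m))"
    unfolding F E by (simp add: algebra_simps power2_eq_square)
  then show ?thesis
    using m by (simp add: F_def E_def)
qed

lemma latin_idem_commute:
  fixes M N :: "real^'x^'x::finite"
  assumes M: "latin_like m t M" and N: "latin_like n u N" and MN: "M ** N = N ** M"
  shows "latin_idem m t M ** latin_idem n u N = latin_idem n u N ** latin_idem m t M"
proof -
  have "M ** all_ones_mat = all_ones_mat ** M" "N ** all_ones_mat = all_ones_mat ** N"
    using symmetric_mult_transpose[of M all_ones_mat] symmetric_mult_transpose[of N all_ones_mat] M N
    by (auto simp: latin_like_def transpose_simps)
  then show ?thesis
    by (simp add: latin_idem_def matrix_mult_simps MN algebra_simps)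
qed

text \<open>The product of two commuting orthogonal projections is again an orthogonal projection,
  and here its trace is 0.\<close>

lemma latin_idem_orthogonal:
  fixes M N :: "real^'x^'x::finite"
  assumes M: "latin_like m t M" and N: "latin_like m u N"
    and MN: "M ** N = N ** M" and tr: "trace (M ** N) = 0"
  shows "latin_idem m t M ** latin_idem m u N = 0"
proof (rule symmetric_idem_eq_0)
  define F E where "F = latin_idem m t M" and "E = latin_idem m u N"
  note F = latin_like_idem[OF M, folded F_def] and E = latin_like_idem[OF N, folded E_def]
  have FE: "F ** E = E ** F"
    using latin_idem_commute[OF M N MN] by (simp add: F_def E_def)
  show "transpose (F ** E) = F ** E"
    using symmetric_mult_transpose[OF F(1) E(1)] FE by simp
  have "(F ** E) ** (F ** E) = (F ** (E ** F)) ** E"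
    by (simp add: matrix_mul_assoc)
  also have "\<dots> = (F ** F) ** (E ** E)"
    by (simp add: matrix_mul_assoc flip: FE)
  finally show "(F ** E) ** (F ** E) = F ** E"
    by (simp add: F E)
  show "trace (F ** E) = 0"
    using latin_like_trace_mult[OF M N tr] latin_like_nonzero[OF M] by (simp add: F_def E_def)
qed

section \<open>Joint eigenspaces\<close>

text \<open>
  \<open>X\<close> acts on every joint eigenspace of the \<open>F l\<close>, given by a character \<open>\<phi>\<close>, by a scalar
  that is an affine function of \<open>\<phi>\<close>. Columns of \<open>Y\<close> play the role of eigenvectors.
\<close>

definition affine_in :: "('i \<Rightarrow> real^'x^'x) \<Rightarrow> 'i set \<Rightarrow> (real^'x^'x::finite) set"
  where "affine_in F K = {X. \<exists>\<alpha> c. \<forall>(Y :: real^'x^'x) \<phi>. all_ones_mat ** Y = 0 \<longrightarrow>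
    (\<forall>l\<in>K. F l ** Y = \<phi> l *\<^sub>R Y) \<longrightarrow> X ** Y = (\<alpha> + (\<Sum>l\<in>K. c l * \<phi> l)) *\<^sub>R Y}"

lemma affine_inI:
  fixes F :: "'i \<Rightarrow> real^'x^'x::finite"
  assumes "\<And>(Y :: real^'x^'x) \<phi>. all_ones_mat ** Y = 0 \<Longrightarrow> (\<And>l. l \<in> K \<Longrightarrow> F l ** Y = \<phi> l *\<^sub>R Y) \<Longrightarrow>
    X ** Y = (\<alpha> + (\<Sum>l\<in>K. c l * \<phi> l)) *\<^sub>R Y"
  shows "X \<in> affine_in F K"
  using assms unfolding affine_in_def by blast

lemma affine_inE:
  fixes F :: "'i \<Rightarrow> real^'x^'x::finite"
  assumes "X \<in> affine_in F K"
  obtains \<alpha> c where "\<And>(Y :: real^'x^'x) \<phi>. all_ones_mat ** Y = 0 \<Longrightarrow> (\<And>l. l \<in> K \<Longrightarrow> F l ** Y = \<phi> l *\<^sub>R Y) \<Longrightarrow>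
    X ** Y = (\<alpha> + (\<Sum>l\<in>K. c l * \<phi> l)) *\<^sub>R Y"
  using assms unfolding affine_in_def by blast

text \<open>Membership of a whole span then follows from membership of its generators.\<close>

lemma subspace_affine_in:
  fixes F :: "'i \<Rightarrow> real^'x^'x::finite"
  shows "subspace (affine_in F K)"
  unfolding subspace_def
proof (intro conjI ballI allI)
  show "0 \<in> affine_in F K"
    by (rule affine_inI[where \<alpha> = 0 and c = "\<lambda>_. 0"]) (simp add: matrix_mult_simps)
next
  fix X Z assume "X \<in> affine_in F K" "Z \<in> affine_in F K"
  then obtain \<alpha> c \<beta> e where
    *: "\<And>(Y :: real^'x^'x) \<phi>. all_ones_mat ** Y = 0 \<Longrightarrow> (\<And>l. l \<in> K \<Longrightarrow> F l ** Y = \<phi> l *\<^sub>R Y) \<Longrightarrow>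
      X ** Y = (\<alpha> + (\<Sum>l\<in>K. c l * \<phi> l)) *\<^sub>R Y"
    "\<And>(Y :: real^'x^'x) \<phi>. all_ones_mat ** Y = 0 \<Longrightarrow> (\<And>l. l \<in> K \<Longrightarrow> F l ** Y = \<phi> l *\<^sub>R Y) \<Longrightarrow>
      Z ** Y = (\<beta> + (\<Sum>l\<in>K. e l * \<phi> l)) *\<^sub>R Y"
    by (elim affine_inE) blast
  show "X + Z \<in> affine_in F K"
  proof (rule affine_inI)
    fix Y :: "real^'x^'x" and \<phi> assume "all_ones_mat ** Y = 0" "\<And>l. l \<in> K \<Longrightarrow> F l ** Y = \<phi> l *\<^sub>R Y"
    from *[OF this] show "(X + Z) ** Y = (\<alpha> + \<beta> + (\<Sum>l\<in>K. (c l + e l) * \<phi> l)) *\<^sub>R Y"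
      by (simp add: matrix_mult_simps sum.distrib algebra_simps)
  qed
next
  fix r X assume "X \<in> affine_in F K"
  then obtain \<alpha> c where
    *: "\<And>(Y :: real^'x^'x) \<phi>. all_ones_mat ** Y = 0 \<Longrightarrow> (\<And>l. l \<in> K \<Longrightarrow> F l ** Y = \<phi> l *\<^sub>R Y) \<Longrightarrow>
      X ** Y = (\<alpha> + (\<Sum>l\<in>K. c l * \<phi> l)) *\<^sub>R Y"
    by (elim affine_inE) blast
  show "r *\<^sub>R X \<in> affine_in F K"
  proof (rule affine_inI)
    fix Y :: "real^'x^'x" and \<phi> assume "all_ones_mat ** Y = 0" "\<And>l. l \<in> K \<Longrightarrow> F l ** Y = \<phi> l *\<^sub>R Y"
    from *[OF this] show "(r *\<^sub>R X) ** Y = (r * \<alpha> + (\<Sum>l\<in>K. (r * c l) * \<phi> l)) *\<^sub>R Y"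
      by (simp add: matrix_mult_simps sum_distrib_left algebra_simps)
  qed
qed

lemma affine_in_basic:
  fixes F :: "'i \<Rightarrow> real^'x^'x::finite"
  assumes "finite K"
  shows "mat 1 \<in> affine_in F K" "all_ones_mat \<in> affine_in F K" "i \<in> K \<Longrightarrow> F i \<in> affine_in F K"
proof -
  show "mat 1 \<in> affine_in F K"
    by (rule affine_inI[where \<alpha> = 1 and c = "\<lambda>_. 0"]) simp
  show "all_ones_mat \<in> affine_in F K"
    by (rule affine_inI[where \<alpha> = 0 and c = "\<lambda>_. 0"]) simp
  show "F i \<in> affine_in F K" if "i \<in> K"
  proof (rule affine_inI[where \<alpha> = 0 and c = "\<lambda>l. if l = i then 1 else 0"])
    fix Y :: "real^'x^'x" and \<phi> assume "\<And>l. l \<in> K \<Longrightarrow> F l ** Y = \<phi> l *\<^sub>R Y"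
    then show "F i ** Y = (0 + (\<Sum>l\<in>K. (if l = i then 1 else 0) * \<phi> l)) *\<^sub>R Y"
      using that assms by (simp add: if_distrib[where f = "\<lambda>x. x * _"] cong: if_cong)
  qed
qed

text \<open>
  For affine \<open>F i ** F j\<close> the characters supported on \<open>{}\<close>, \<open>{i, j}\<close>, \<open>{j}\<close> and one of
  \<open>{i}\<close>, \<open>{i, j'}\<close> cannot all occur, as \<open>\<phi> i * \<phi> j\<close> is not affine on them.
\<close>

lemma affine_product_imp_singleton:
  fixes F :: "'i \<Rightarrow> real^'x^'x::finite"
  assumes fin: "finite G" "finite H" and disj: "G \<inter> H = {}"
    and orthG: "\<And>i j. i \<in> G \<Longrightarrow> j \<in> G \<Longrightarrow> F i ** F j = (if i = j then F i else 0)"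
    and orthH: "\<And>i j. i \<in> H \<Longrightarrow> j \<in> H \<Longrightarrow> F i ** F j = (if i = j then F i else 0)"
    and comm: "\<And>i j. i \<in> G \<Longrightarrow> j \<in> H \<Longrightarrow> F i ** F j = F j ** F i"
    and JF: "\<And>l. l \<in> G \<union> H \<Longrightarrow> all_ones_mat ** F l = 0"
    and FJ: "\<And>l. l \<in> G \<union> H \<Longrightarrow> F l ** all_ones_mat = 0"
    and ij: "i \<in> G" "j \<in> H"
    and affine: "F i ** F j \<in> affine_in F (G \<union> H)"
    and nz: "\<And>j'. j' \<in> H \<Longrightarrow> F i ** F j' \<noteq> 0"
    and R: "(mat 1 - sum F G) ** (mat 1 - sum F H) \<noteq> (1 / real CARD('x)) *\<^sub>R all_ones_mat"
    and nz_H: "\<And>j'. j' \<in> H \<Longrightarrow> F j' ** (mat 1 - sum F G) \<noteq> 0"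
  shows "F i ** (mat 1 - sum F H) = 0 \<and> H = {j}"
proof -
  obtain \<alpha> c where \<alpha>c: "\<And>(Y :: real^'x^'x) \<phi>. all_ones_mat ** Y = 0 \<Longrightarrow>
      (\<And>l. l \<in> G \<union> H \<Longrightarrow> F l ** Y = \<phi> l *\<^sub>R Y) \<Longrightarrow>
      (F i ** F j) ** Y = (\<alpha> + (\<Sum>l\<in>G\<union>H. c l * \<phi> l)) *\<^sub>R Y"
    using affine by (elim affine_inE) blast
  \<comment> \<open>A nonzero \<open>Y\<close> as assumed here witnesses that the 0-1 character
    supported on \<open>S\<close> occurs. Comparing the two ways in which \<open>F i ** F j\<close>
    acts on \<open>Y\<close> gives one linear equation for \<open>\<alpha>\<close> and
    \<open>c\<close>.\<close>
  have ev: "(if i \<in> S \<and> j \<in> S then 1 else 0) = \<alpha> + sum c S"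
    if Y: "Y \<noteq> 0" "all_ones_mat ** Y = 0" "S \<subseteq> G \<union> H"
      "\<And>l. l \<in> G \<union> H \<Longrightarrow> F l ** Y = (if l \<in> S then Y else 0)" for Y :: "real^'x^'x" and S
  proof -
    have "(F i ** F j) ** Y = F i ** (F j ** Y)"
      by (simp add: matrix_mul_assoc)
    then have "(F i ** F j) ** Y = (if i \<in> S \<and> j \<in> S then 1 else 0) *\<^sub>R Y"
      using ij Y(4)[of i] Y(4)[of j] by (simp add: matrix_mult_simps)
    moreover have "(F i ** F j) ** Y = (\<alpha> + (\<Sum>l\<in>G\<union>H. c l * (if l \<in> S then 1 else 0))) *\<^sub>R Y"
      by (rule \<alpha>c[OF Y(2)]) (use Y(4) in auto)
    moreover have "(\<Sum>l\<in>G\<union>H. c l * (if l \<in> S then 1 else 0)) = sum c S"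
      using fin Y(3) by (intro sum.mono_neutral_cong_right) auto
    ultimately have "(if i \<in> S \<and> j \<in> S then 1 else 0) *\<^sub>R Y = (\<alpha> + sum c S) *\<^sub>R Y"
      by (simp only:)
    then show ?thesis
      using Y(1) unfolding scaleR_cancel_right by blast
  qed
  define P Q where "P = sum F G" and "Q = sum F H"
  have FP: "F l ** P = F l" if "l \<in> G" for l
    using that fin orthG by (simp add: P_def matrix_mult.sum_right)
  have FQ: "F l ** Q = F l" if "l \<in> H" for l
    using that fin orthH by (simp add: Q_def matrix_mult.sum_right)
  have PF: "F l ** P = P ** F l" if "l \<in> H" for l
    using that by (auto simp: P_def matrix_mult.sum_right matrix_mult.sum_left intro!: sum.cong comm[symmetric])
  have JP: "all_ones_mat ** P = 0" and JQ: "all_ones_mat ** Q = 0"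
    using JF by (simp_all add: P_def Q_def matrix_mult.sum_right)
  \<comment> \<open>The empty character. Its eigenspace also contains the all-ones vector, whose
    projection is subtracted; \<open>R\<close> says that something remains.\<close>
  have "(if i \<in> {} \<and> j \<in> {} then 1 else 0) = \<alpha> + sum c {}"
  proof (rule ev)
    let ?R = "(mat 1 - P) ** (mat 1 - Q) - (1 / real CARD('x)) *\<^sub>R all_ones_mat"
    show "?R \<noteq> 0"
      using R by (simp add: P_def Q_def)
    show "all_ones_mat ** ?R = 0"
      by (simp add: matrix_mult_simps matrix_mul_assoc JP JQ all_ones_mult_all_ones)
    show "F l ** ?R = (if l \<in> {} then ?R else 0)" if "l \<in> G \<union> H" for l
    proof (cases "l \<in> G")
      case True
      then show ?thesis
        using FJ[OF that] by (simp add: matrix_mult_simps matrix_mul_assoc FP)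
    next
      case False
      then have "l \<in> H" using that by simp
      then have "P ** F l ** Q = P ** F l"
        by (simp add: FQ flip: matrix_mul_assoc)
      then show ?thesis
        using FJ[OF that] \<open>l \<in> H\<close> by (simp add: matrix_mult_simps matrix_mul_assoc FQ PF)
    qed
  qed simp
  then have \<alpha>: "\<alpha> = 0" by simp
  \<comment> \<open>\<open>F i ** F j'\<close> witnesses the character supported on
    \<open>{i, j'}\<close>, for every \<open>j'\<close> in \<open>H\<close>.\<close>
  have both: "all_ones_mat ** (F i ** F j') = 0"
      "l \<in> G \<union> H \<Longrightarrow> F l ** (F i ** F j') = (if l \<in> {i, j'} then F i ** F j' else 0)"
    if "j' \<in> H" for j' l
  proof -
    show "all_ones_mat ** (F i ** F j') = 0"
      using ij by (simp add: matrix_mul_assoc JF matrix_mult_simps)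
    assume l: "l \<in> G \<union> H"
    show "F l ** (F i ** F j') = (if l \<in> {i, j'} then F i ** F j' else 0)"
    proof (cases "l \<in> G")
      case True
      then show ?thesis
        using ij disj that orthG[OF True ij(1)] by (auto simp: matrix_mul_assoc matrix_mult_simps)
    next
      case False
      then have "l \<in> H" using l by simp
      then have "F l ** (F i ** F j') = F i ** (F l ** F j')"
        using comm[OF ij(1), of l] by (simp add: matrix_mul_assoc)
      then show ?thesis
        using ij disj \<open>l \<in> H\<close> orthH[OF \<open>l \<in> H\<close> that] by (auto simp: matrix_mult_simps)
    qed
  qed
  have c_both: "(if j' = j then 1 else 0) = c i + c j'" if "j' \<in> H" for j'
  proof -
    have "(if i \<in> {i, j'} \<and> j \<in> {i, j'} then 1 else 0) = \<alpha> + sum c {i, j'}"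
      by (rule ev[OF nz[OF that] both(1)[OF that] _ both(2)[OF that]]) (use that ij in auto)
    moreover have "i \<noteq> j'" "i \<noteq> j"
      using that ij disj by auto
    ultimately show ?thesis
      using \<alpha> by (auto split: if_splits)
  qed
  \<comment> \<open>\<open>F j' ** (mat 1 - P)\<close> witnesses the character supported on
    \<open>{j'}\<close>.\<close>
  have c_H: "c j' = 0" if "j' \<in> H" for j'
  proof -
    have "(if i \<in> {j'} \<and> j \<in> {j'} then 1 else 0) = \<alpha> + sum c {j'}"
    proof (rule ev)
      show "F j' ** (mat 1 - P) \<noteq> 0"
        using nz_H[OF that] by (simp add: P_def)
      show "all_ones_mat ** (F j' ** (mat 1 - P)) = 0"
        using that by (simp add: matrix_mul_assoc JF matrix_mult_simps)
      show "F l ** (F j' ** (mat 1 - P)) = (if l \<in> {j'} then F j' ** (mat 1 - P) else 0)"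
        if l: "l \<in> G \<union> H" for l
      proof (cases "l \<in> G")
        case True
        then have "F l ** (F j' ** (mat 1 - P)) = F j' ** (F l ** (mat 1 - P))"
          using comm[OF True \<open>j' \<in> H\<close>] by (simp add: matrix_mul_assoc)
        then show ?thesis
          using True \<open>j' \<in> H\<close> disj by (auto simp: matrix_mult_simps FP)
      next
        case False
        then have "l \<in> H" using l by simp
        then show ?thesis
          using orthH[OF \<open>l \<in> H\<close> \<open>j' \<in> H\<close>] by (auto simp: matrix_mul_assoc matrix_mult_simps)
      qed
    qed (use that in auto)
    moreover have "i \<noteq> j'"
      using that ij disj by auto
    ultimately show ?thesis
      using \<alpha> by simp
  qed
  have c_i: "c i = 1"
    using c_both[OF ij(2)] c_H[OF ij(2)] by simp
  \<comment> \<open>For \<open>j'\<close> different from \<open>j\<close> the equation in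
    \<open>c_both\<close> would read \<open>0 = 1 + 0\<close>.\<close>
  have "j' = j" if "j' \<in> H" for j'
    using c_both[OF that] c_H[OF that] c_i by (simp split: if_splits)
  then have "H = {j}"
    using ij by blast
  \<comment> \<open>Otherwise the character supported on \<open>{i}\<close> occurs as well and
    forces \<open>c i = 0\<close>.\<close>
  moreover have "F i ** (mat 1 - Q) = 0"
  proof (rule ccontr)
    assume *: "F i ** (mat 1 - Q) \<noteq> 0"
    have "(if i \<in> {i} \<and> j \<in> {i} then 1 else 0) = \<alpha> + sum c {i}"
    proof (rule ev[OF *])
      show "all_ones_mat ** (F i ** (mat 1 - Q)) = 0"
        using ij by (simp add: matrix_mul_assoc JF matrix_mult_simps)
      show "F l ** (F i ** (mat 1 - Q)) = (if l \<in> {i} then F i ** (mat 1 - Q) else 0)"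
        if l: "l \<in> G \<union> H" for l
      proof (cases "l \<in> G")
        case True
        then show ?thesis
          using orthG[OF True ij(1)] by (auto simp: matrix_mul_assoc matrix_mult_simps)
      next
        case False
        then have "l \<in> H" using l by simp
        then have "F l ** (F i ** (mat 1 - Q)) = F i ** (F l ** (mat 1 - Q))"
          using comm[OF ij(1) \<open>l \<in> H\<close>] by (simp add: matrix_mul_assoc)
        then show ?thesis
          using \<open>l \<in> H\<close> ij disj by (auto simp: matrix_mult_simps FQ)
      qed
    qed (use ij in auto)
    moreover have "i \<noteq> j"
      using ij disj by auto
    ultimately show False
      using \<alpha> c_i by simp
  qed
  ultimately show ?thesis
    by (simp add: Q_def)
qed

text \<open>Traces decide which joint eigenspaces occur. With \<open>T\<close> and \<open>U\<close>
  the sums of \<open>t\<close> over \<open>G\<close> and \<open>H\<close>, the only ones that may be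
  missing are those of \<open>F i ** (mat 1 - Q)\<close>, when \<open>m - 1 + 2 * U = 0\<close>, and
  of \<open>F j ** (mat 1 - P)\<close>, when \<open>2 * T = m + 1\<close>. Assumption
  \<open>pos\<close>, which bounds the sum of the valencies strictly below \<open>v - 1\<close>,
  excludes that both are missing.\<close>

lemma opposite_types_imp_conference:
  fixes A :: "'i \<Rightarrow> real^'x^'x::finite" and t :: "'i \<Rightarrow> real"
  assumes fin: "finite G" "finite H" and disj: "G \<inter> H = {}" and ne: "G \<noteq> {}" "H \<noteq> {}"
    and G: "\<And>i. i \<in> G \<Longrightarrow> latin_like m (t i) (A i) \<and> t i * m > 0"
    and H: "\<And>i. i \<in> H \<Longrightarrow> latin_like (- m) (t i) (A i) \<and> t i * (- m) > 0"
    and tr0: "\<And>i j. i \<in> G \<union> H \<Longrightarrow> j \<in> G \<union> H \<Longrightarrow> i \<noteq> j \<Longrightarrow> trace (A i ** A j) = 0"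
    and comm: "\<And>i j. i \<in> G \<union> H \<Longrightarrow> j \<in> G \<union> H \<Longrightarrow> A i ** A j = A j ** A i"
    and mem: "\<And>i j. i \<in> G \<union> H \<Longrightarrow> j \<in> G \<union> H \<Longrightarrow>
      A i ** A j \<in> span (insert (mat 1) (insert all_ones_mat (A ` (G \<union> H))))"
    and pos: "(\<Sum>i\<in>G. t i * (m - 1)) + (\<Sum>i\<in>H. t i * (- m - 1)) < m\<^sup>2 - 1"
  shows "(\<exists>i. G = {i} \<and> 2 * t i = m + 1) \<or> (\<exists>j. H = {j} \<and> 2 * t j = - m + 1)"
proof -
  define s where "s l = (if l \<in> G then m else - m)" for l
  define F where "F l = latin_idem (s l) (t l) (A l)" for l
  define K where "K = G \<union> H"
  have finK: "finite K"
    using fin by (simp add: K_def)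
  have L: "latin_like (s l) (t l) (A l)" "t l * s l > 0" if "l \<in> K" for l
    using that G[of l] H[of l] disj by (auto simp: s_def K_def)
  have sG: "s l = m" if "l \<in> G" for l
    using that by (simp add: s_def)
  have sH: "s l = - m" if "l \<in> H" for l
    using that disj by (auto simp: s_def)
  have m: "m \<noteq> 0" and v: "real CARD('x) = m\<^sup>2"
    using G ne(1) latin_like_nonzero unfolding latin_like_def by fastforce+
  note idem = latin_like_idem[OF L(1), folded F_def]
  have Fcomm: "F i ** F j = F j ** F i" if "i \<in> K" "j \<in> K" for i j
    unfolding F_def using latin_idem_commute[OF L(1)[OF that(1)] L(1)[OF that(2)]] comm that
    by (simp add: K_def)
  have orth: "F i ** F j = (if i = j then F i else 0)" if "i \<in> K" "j \<in> K" "s i = s j" for i j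
    unfolding F_def using latin_idem_orthogonal[OF L(1)[OF that(1)], of "t j" "A j"] L(1)[OF that(2)]
      comm tr0 that idem(2)[OF that(1)] unfolding F_def K_def by (cases "i = j") auto
  have trGH: "trace (F i ** F j) = - 2 * t i * t j" if "i \<in> G" "j \<in> H" for i j
  proof -
    have "trace (A i ** A j) = 0"
      using that disj by (intro tr0) auto
    then have "m * trace (F i ** F j) = m * (- 2 * t i * t j)"
      using latin_like_trace_mult[OF L(1) L(1), of i j] that
      by (simp add: K_def F_def sG sH algebra_simps)
    then show ?thesis
      using m by (simp only: mult_cancel_left) simp
  qed
  \<comment> \<open>\<open>T\<close> has the sign of \<open>m\<close> and \<open>U\<close> the
    opposite sign, so \<open>T * U\<close> is negative.\<close>
  define T U where "T = sum t G" and "U = sum t H"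
  have "0 < T * m" "0 < U * (- m)"
    unfolding T_def U_def sum_distrib_right using fin ne G H by (auto intro!: sum_pos)
  then have "0 < (T * m) * (U * (- m))"
    by (rule mult_pos_pos)
  then have "0 < m\<^sup>2 * (- (T * U))"
    by (simp add: power2_eq_square algebra_simps)
  then have TU: "T * U < 0"
    using m by (simp add: zero_less_mult_iff mult_less_0_iff)
  have pos': "T * (m - 1) + U * (- m - 1) < m\<^sup>2 - 1"
    using pos by (simp add: T_def U_def sum_distrib_right)
  define P Q where "P = sum F G" and "Q = sum F H"
  have PQ: "P ** Q = Q ** P"
    unfolding P_def Q_def matrix_mult.sum_left matrix_mult.sum_right
    by (subst sum.swap) (auto intro!: sum.cong Fcomm simp: K_def)
  \<comment> \<open>The trace of the left side exceeds 1 by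
    \<open>m\<^sup>2 - 1 - T * (m - 1) - U * (- m - 1) - 2 * T * U\<close>, which is positive by
    \<open>pos'\<close> and \<open>TU\<close>.\<close>
  have R: "(mat 1 - P) ** (mat 1 - Q) \<noteq> (1 / real CARD('x)) *\<^sub>R all_ones_mat"
  proof
    assume "(mat 1 - P) ** (mat 1 - Q) = (1 / real CARD('x)) *\<^sub>R all_ones_mat"
    then have "trace ((mat 1 - P) ** (mat 1 - Q)) = 1"
      using m by (simp add: trace_simps trace_all_ones v)
    moreover have "trace ((mat 1 - P) ** (mat 1 - Q)) = m\<^sup>2 - trace P - trace Q + trace (P ** Q)"
      by (simp add: matrix_mult_simps trace_simps trace_mat_1 v)
    moreover have "trace P = T * (m - 1)"
      unfolding P_def T_def using idem(5) by (simp add: trace_simps K_def sG sum_distrib_right)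
    moreover have "trace Q = U * (- m - 1)"
      unfolding Q_def U_def using idem(5) by (simp add: trace_simps K_def sH sum_distrib_right)
    moreover have "trace (P ** Q) = - 2 * (T * U)"
    proof -
      have "trace (P ** Q) = (\<Sum>i\<in>G. \<Sum>j\<in>H. - 2 * t i * t j)"
        unfolding P_def Q_def matrix_mult.sum_left matrix_mult.sum_right trace_simps
        by (subst sum.swap) (simp add: trGH)
      then show ?thesis
        unfolding T_def U_def sum_product by (simp add: sum_distrib_left mult.assoc)
    qed
    ultimately show False
      using pos' TU by argo
  qed
  have nz: "F i ** F j \<noteq> 0" if "i \<in> G" "j \<in> H" for i j
  proof
    assume "F i ** F j = 0"
    then have "t i * t j = 0"
      using trGH[OF that] by (simp add: trace_simps)
    then show False
      using G[OF that(1)] H[OF that(2)] by auto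
  qed
  have trG: "trace (F i ** (mat 1 - Q)) = t i * (m - 1 + 2 * U)" if "i \<in> G" for i
  proof -
    have "trace (F i ** Q) = - 2 * t i * U"
      using that by (simp add: Q_def U_def matrix_mult.sum_right trace_simps trGH sum_distrib_left)
    then show ?thesis
      using idem(5)[of i] that by (simp add: matrix_mult_simps trace_simps K_def sG algebra_simps)
  qed
  have trH: "trace (F j ** (mat 1 - P)) = t j * (- m - 1 + 2 * T)" if "j \<in> H" for j
  proof -
    have "trace (F j ** F i) = - 2 * t j * t i" if "i \<in> G" for i
      using trGH[OF that \<open>j \<in> H\<close>] Fcomm[of i j] that \<open>j \<in> H\<close> by (simp add: K_def)
    then have "trace (F j ** P) = - 2 * t j * T"
      by (simp add: P_def T_def matrix_mult.sum_right trace_simps sum_distrib_left)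
    then show ?thesis
      using idem(5)[of j] that by (simp add: matrix_mult_simps trace_simps K_def sH algebra_simps)
  qed
  have AJ: "A i ** all_ones_mat = (t i * (s i - 1)) *\<^sub>R all_ones_mat"
      "all_ones_mat ** A i = (t i * (s i - 1)) *\<^sub>R all_ones_mat" if "i \<in> K" for i
    using L(1)[OF that] symmetric_mult_transpose[of "A i" all_ones_mat]
    by (auto simp: latin_like_def transpose_simps)
  \<comment> \<open>Each \<open>A l\<close> is a combination of \<open>F l\<close>,
    \<open>mat 1\<close> and \<open>all_ones_mat\<close>, so the span in \<open>mem\<close> consists
    of affine matrices. Conversely \<open>F i ** F j\<close> is a combination of
    \<open>A i ** A j\<close>, \<open>A i\<close>, \<open>A j\<close>, \<open>mat 1\<close> and
    \<open>all_ones_mat\<close>.\<close>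
  have affine: "F i ** F j \<in> affine_in F K" if "i \<in> K" "j \<in> K" for i j
  proof -
    note sub = subspace_affine_in[of F K]
    have A: "A l \<in> affine_in F K" if "l \<in> K" for l
    proof -
      have "A l = s l *\<^sub>R F l - t l *\<^sub>R mat 1 + (t l / s l) *\<^sub>R all_ones_mat"
        unfolding F_def by (rule latin_idem_expand[OF latin_like_nonzero[OF L(1)[OF that]]])
      then show ?thesis
        using affine_in_basic[where F = F, OF finK] that
        by (metis subspace_add subspace_diff subspace_scale sub)
    qed
    have "span (insert (mat 1) (insert all_ones_mat (A ` K))) \<subseteq> affine_in F K"
      using A affine_in_basic[where F = F, OF finK] sub by (intro span_minimal) auto
    then have AA: "A i ** A j \<in> affine_in F K"
      using mem that unfolding K_def by blast
    show ?thesis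
      unfolding F_def[of i] F_def[of j] latin_idem_def
      by (simp only: matrix_mult_simps AJ that all_ones_mult_all_ones)
        (intro subspace_add[OF sub] subspace_diff[OF sub] subspace_scale[OF sub] AA A
          affine_in_basic[OF finK] that)
  qed
  obtain i j where ij: "i \<in> G" "j \<in> H"
    using ne by blast
  \<comment> \<open>If \<open>2 * T = m + 1\<close> fails, every \<open>F j ** (mat 1 - P)\<close>
    is nonzero and the preceding lemma applies directly; otherwise it applies with \<open>G\<close>
    and \<open>H\<close> exchanged.\<close>
  show ?thesis
  proof (cases "2 * T = m + 1")
    case False
    have "F i ** (mat 1 - Q) = 0 \<and> H = {j}"
      unfolding Q_def
    proof (rule affine_product_imp_singleton[OF fin disj _ _ _ _ _ ij])
      show "F j' ** (mat 1 - sum F G) \<noteq> 0" if "j' \<in> H" for j'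
        using trH[OF that] H[OF that] False by (auto simp: P_def trace_simps)
      show "F i ** F j' \<noteq> 0" if "j' \<in> H" for j'
        by (rule nz[OF ij(1) that])
    qed (use ij R orth Fcomm affine idem in \<open>auto simp: P_def Q_def K_def sG sH\<close>)
    then have "t i * (m - 1 + 2 * t j) = 0" "H = {j}"
      using trG[OF ij(1)] by (auto simp: trace_simps U_def)
    then show ?thesis
      using G[OF ij(1)] by auto
  next
    case True
    \<comment> \<open>If both were missing, \<open>T * (m - 1) + U * (- m - 1)\<close> would equal
      \<open>m\<^sup>2 - 1\<close>.\<close>
    have "m - 1 + 2 * U \<noteq> 0"
    proof
      assume "m - 1 + 2 * U = 0"
      then have U: "U = (1 - m) / 2" and T: "T = (m + 1) / 2"
        using True by auto
      show False
        using pos' unfolding U T by (simp add: field_simps power2_eq_square)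
    qed
    have "F j ** (mat 1 - P) = 0 \<and> G = {i}"
      unfolding P_def
    proof (rule affine_product_imp_singleton[OF fin(2,1) _ _ _ _ _ _ ij(2,1)])
      show "F i' ** (mat 1 - sum F H) \<noteq> 0" if "i' \<in> G" for i'
        using trG[OF that] G[OF that] \<open>m - 1 + 2 * U \<noteq> 0\<close> by (auto simp: Q_def trace_simps)
      show "(mat 1 - sum F H) ** (mat 1 - sum F G) \<noteq> (1 / real CARD('x)) *\<^sub>R all_ones_mat"
        using R PQ by (simp add: matrix_mult_simps algebra_simps flip: P_def Q_def)
      show "F j ** F i' \<noteq> 0" if "i' \<in> G" for i'
        using nz[OF that ij(2)] Fcomm[of i' j] that ij by (simp add: K_def)
    qed (use ij disj orth Fcomm affine idem in \<open>auto simp: K_def sG sH Un_commute\<close>)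
    then have "T = t i"
      by (simp add: T_def)
    then show ?thesis
      using True \<open>F j ** (mat 1 - P) = 0 \<and> G = {i}\<close> by auto
  qed
qed

section \<open>Fusion of association schemes\<close>

lemma scheme_entry:
  assumes "symmetric_association_scheme I z A" "i \<in> I"
  shows "A i $ x $ y = 0 \<or> A i $ x $ y = 1"
  using assms unfolding symmetric_association_scheme_def zero_one_mat_def by blast

lemma scheme_entry_sum:
  assumes "symmetric_association_scheme I z A"
  shows "(\<Sum>i\<in>I. A i $ x $ y) = 1"
proof -
  have "(\<Sum>i\<in>I. A i) $ x $ y = 1"
    using assms by (simp add: symmetric_association_scheme_def)
  then show ?thesis by simp
qed

lemma scheme_sum_entry:
  assumes "symmetric_association_scheme I z A" "S \<subseteq> I"
  shows "(\<Sum>i\<in>S. A i) $ x $ y = 0 \<or> (\<Sum>i\<in>S. A i) $ x $ y = 1"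
proof (cases "\<exists>i\<in>S. A i $ x $ y = 1")
  case True
  then obtain i where i: "i \<in> S" "A i $ x $ y = 1" by blast
  have fin: "finite I"
    using assms(1) by (simp add: symmetric_association_scheme_def)
  have nonneg: "0 \<le> A l $ x $ y" if "l \<in> I" for l
    using scheme_entry[OF assms(1) that, of x y] by auto
  have "(\<Sum>l\<in>S. A l $ x $ y) \<le> (\<Sum>l\<in>I. A l $ x $ y)"
    using fin assms(2) nonneg by (intro sum_mono2) auto
  moreover have "(\<Sum>l\<in>{i}. A l $ x $ y) \<le> (\<Sum>l\<in>S. A l $ x $ y)"
    using fin assms(2) nonneg i by (intro sum_mono2) (auto intro: finite_subset)
  ultimately show ?thesis
    using i scheme_entry_sum[OF assms(1), of x y] by simp
next
  case False
  then have "A i $ x $ y = 0" if "i \<in> S" for i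
    using scheme_entry[OF assms(1), of i x y] that assms(2) by blast
  then show ?thesis by simp
qed

text \<open>Two entries 1 would add up to an entry 2 of the sum over
  \<open>S \<union> T\<close>.\<close>

lemma scheme_disjoint:
  assumes sch: "symmetric_association_scheme I z A" and "S \<subseteq> I" "T \<subseteq> I" "S \<inter> T = {}"
  shows "(\<Sum>i\<in>S. A i) $ x $ y * (\<Sum>i\<in>T. A i) $ x $ y = 0"
proof -
  have "finite S" "finite T"
    using assms finite_subset by (auto simp: symmetric_association_scheme_def)
  then have "(\<Sum>i\<in>S\<union>T. A i) $ x $ y = (\<Sum>i\<in>S. A i) $ x $ y + (\<Sum>i\<in>T. A i) $ x $ y"
    using assms(4) by (simp add: sum.union_disjoint)
  then show ?thesis
    using scheme_sum_entry[OF sch, of "S \<union> T" x y] scheme_sum_entry[OF sch, of S x y]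
      scheme_sum_entry[OF sch, of T x y] assms by auto
qed

text \<open>The trace adds up the entrywise products, and different relations have disjoint
  supports.\<close>

lemma scheme_trace_mult:
  fixes A :: "'i \<Rightarrow> real^'x^'x::finite"
  assumes sch: "symmetric_association_scheme I z A" and "i \<in> I" "j \<in> I" "i \<noteq> j"
  shows "trace (A i ** A j) = 0"
proof -
  have "transpose (A j) = A j"
    using assms by (simp add: symmetric_association_scheme_def)
  moreover have "A i $ x $ y * A j $ x $ y = 0" for x y
    using scheme_disjoint[OF sch, of "{i}" "{j}" x y] assms by simp
  ultimately show ?thesis
    by (simp only: trace_mult_symmetric sum.neutral_const)
qed

text \<open>The product is a combination of symmetric matrices, hence symmetric, while transposing
  reverses its factors.\<close>

lemma scheme_commute:
  fixes A :: "'i \<Rightarrow> real^'x^'x::finite"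
  assumes "symmetric_association_scheme I z A" "i \<in> I" "j \<in> I"
  shows "A i ** A j = A j ** A i"
proof -
  have sym: "transpose (A h) = A h" if "h \<in> I" for h
    using assms(1) that by (simp add: symmetric_association_scheme_def)
  obtain p where "A i ** A j = (\<Sum>h\<in>I. p i j h *\<^sub>R A h)"
    using assms unfolding symmetric_association_scheme_def by blast
  then have "transpose (A i ** A j) = A i ** A j"
    by (simp add: transpose_simps sym)
  then show ?thesis
    using symmetric_mult_transpose[OF sym[OF assms(2)] sym[OF assms(3)]] by simp
qed

lemma scheme_mult_span:
  assumes "symmetric_association_scheme I z A" "i \<in> I" "j \<in> I"
  shows "A i ** A j \<in> span (A ` I)"
proof -
  obtain p where p: "A i ** A j = (\<Sum>h\<in>I. p i j h *\<^sub>R A h)"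
    using assms unfolding symmetric_association_scheme_def by blast
  show ?thesis
    unfolding p by (intro span_sum span_scale span_base) auto
qed

text \<open>Since \<open>m\<close> is the same for all relations, merging a part \<open>S\<close>
  produces \<open>m *\<^sub>R sum F S\<close> up to multiples of \<open>mat 1\<close> and
  \<open>all_ones_mat\<close>. Sums of \<open>F\<close> over different parts are again orthogonal
  idempotents, so the span of the merged matrices is closed under multiplication. Some
  \<open>F i\<close> may be 0, which accommodates an empty relation.\<close>

lemma amorphic_if_orthogonal_idempotents:
  fixes A F :: "nat \<Rightarrow> real^'x^'x::finite"
  assumes sch: "symmetric_association_scheme {0..d} 0 A" and m: "m \<noteq> 0"
    and A: "\<And>i. i \<in> {1..d} \<Longrightarrow> A i = m *\<^sub>R F i - t i *\<^sub>R mat 1 + s i *\<^sub>R all_ones_mat"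
    and orth: "\<And>i j. i \<in> {1..d} \<Longrightarrow> j \<in> {1..d} \<Longrightarrow> F i ** F j = (if i = j then F i else 0)"
    and FJ: "\<And>i. i \<in> {1..d} \<Longrightarrow> F i ** all_ones_mat = 0 \<and> all_ones_mat ** F i = 0"
  shows "amorphic d A"
  unfolding amorphic_def
proof (intro allI impI)
  fix P assume P: "partition_on {0..d} P \<and> {0} \<in> P"
  define B where "B S = (\<Sum>l\<in>S. A l)" for S
  have B0: "B {0} = mat 1"
    using sch by (simp add: B_def symmetric_association_scheme_def)
  have finP: "finite P"
    using P finite_elements[of "{0..d}" P] by simp
  have sub: "S \<subseteq> {0..d}" if "S \<in> P" for S
    using P that by (auto simp: partition_on_def)
  have disj: "S \<inter> T = {}" if "S \<in> P" "T \<in> P" "S \<noteq> T" for S T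
    using P that by (auto simp: partition_on_def disjoint_def)
  have sub1: "S \<subseteq> {1..d}" if "S \<in> P" "S \<noteq> {0}" for S
    using disj[of S "{0}"] sub[of S] that P by (auto simp: Suc_le_eq)
  \<comment> \<open>Equal matrices with disjoint supports vanish, so two parts with equal sums would
    contain two different indices of the zero matrix, against the injectivity of
    \<open>A\<close>.\<close>
  have inj: "inj_on B P"
  proof (rule inj_onI, rule ccontr)
    fix S T assume ST: "S \<in> P" "T \<in> P" "B S = B T" "S \<noteq> T"
    have "B S $ x $ y * B T $ x $ y = 0" for x y
      unfolding B_def by (rule scheme_disjoint[OF sch sub[OF ST(1)] sub[OF ST(2)] disj[OF ST(1,2,4)]])
    then have 0: "B S $ x $ y = 0" for x y
      using ST(3) by simp
    have *: "A l = 0" if "U \<in> P" "B U = B S" "l \<in> U" for U l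
    proof -
      have "A l $ x $ y = 0" for x y
      proof -
        have "(\<Sum>i\<in>U. A i $ x $ y) = 0"
          using 0[of x y] unfolding that(2)[symmetric] by (simp add: B_def)
        moreover have "0 \<le> A i $ x $ y" if "i \<in> U" for i
          using scheme_entry[OF sch, of i x y] that sub[OF \<open>U \<in> P\<close>] by fastforce
        ultimately show ?thesis
          using \<open>l \<in> U\<close> finite_subset[OF sub[OF \<open>U \<in> P\<close>]] by (simp add: sum_nonneg_eq_0_iff)
      qed
      then show ?thesis by (simp add: vec_eq_iff)
    qed
    have "S \<noteq> {}" "T \<noteq> {}"
      using P ST by (auto simp: partition_on_def)
    then obtain k l where kl: "k \<in> S" "l \<in> T" by blast
    then have "A k = A l"
      using *[OF ST(1) _ kl(1)] *[OF ST(2) _ kl(2)] ST(3) by simp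
    then have "k = l"
      using sch kl sub[OF ST(1)] sub[OF ST(2)]
      by (auto simp: symmetric_association_scheme_def inj_on_def)
    then show False
      using disj[OF ST(1,2,4)] kl by blast
  qed
  have sumB: "(\<Sum>S\<in>P. B S) = all_ones_mat"
  proof -
    have "(\<Sum>S\<in>P. B S) = sum A (\<Union>P)"
      unfolding B_def using disj by (subst sum.Union_disjoint) (auto intro: finite_subset[OF sub])
    also have "\<Union>P = {0..d}"
      using P by (simp add: partition_on_def)
    finally show ?thesis
      using sch by (simp add: symmetric_association_scheme_def)
  qed
  have I_span: "mat 1 \<in> span (B ` P)"
    using P B0 by (metis image_eqI span_base)
  have J_span: "all_ones_mat \<in> span (B ` P)"
    unfolding sumB[symmetric] by (intro span_sum span_base) auto
  have B_span: "B S \<in> span (B ` P)" if "S \<in> P" for S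
    using that by (intro span_base) auto
  have prod: "B S ** B T \<in> span (B ` P)" if ST: "S \<in> P" "T \<in> P" for S T
  proof (cases "S = {0} \<or> T = {0}")
    case True
    then show ?thesis
      using B0 B_span ST by auto
  next
    case False
    have expand: "B U = m *\<^sub>R sum F U - sum t U *\<^sub>R mat 1 + sum s U *\<^sub>R all_ones_mat"
      if "U \<subseteq> {1..d}" for U
    proof -
      have "B U = (\<Sum>i\<in>U. m *\<^sub>R F i - t i *\<^sub>R mat 1 + s i *\<^sub>R all_ones_mat)"
        unfolding B_def using A that by (intro sum.cong) auto
      then show ?thesis
        by (simp add: sum.distrib sum_subtractf scaleR_sum_right scaleR_sum_left)
    qed
    have S: "S \<subseteq> {1..d}" and T: "T \<subseteq> {1..d}"
      using False sub1 ST by auto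
    then have fin: "finite S" "finite T"
      using finite_subset by blast+
    \<comment> \<open>The expansion is solved for \<open>sum F S\<close>; this division is where
      \<open>m\<close> must be nonzero.\<close>
    have "m *\<^sub>R sum F S = B S + sum t S *\<^sub>R mat 1 - sum s S *\<^sub>R all_ones_mat"
      using expand[OF S] by simp
    moreover have "\<dots> \<in> span (B ` P)"
      by (intro span_add span_diff span_scale I_span J_span B_span ST)
    ultimately have "(1/m) *\<^sub>R (m *\<^sub>R sum F S) \<in> span (B ` P)"
      by (metis span_scale)
    then have F_span: "sum F S \<in> span (B ` P)"
      using m by simp
    have sumFJ: "sum F U ** all_ones_mat = 0" "all_ones_mat ** sum F U = 0" if "U \<subseteq> {1..d}" for U
      unfolding matrix_mult.sum_left matrix_mult.sum_right using FJ that by (blast intro: sum.neutral)+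
    have "sum F S ** B T = m *\<^sub>R (sum F S ** sum F T) - sum t T *\<^sub>R sum F S"
      using sumFJ[OF S] by (simp add: expand[OF T] matrix_mult_simps)
    moreover have "sum F S ** sum F T = (if S = T then sum F S else 0)"
    proof -
      have "sum F S ** sum F T = (\<Sum>i\<in>S. F i ** sum F T)"
        by (rule matrix_mult.sum_left)
      also have "\<dots> = (\<Sum>i\<in>S. \<Sum>j\<in>T. if i = j then F i else 0)"
        unfolding matrix_mult.sum_right using S T by (intro sum.cong refl orth) auto
      also have "\<dots> = (\<Sum>i\<in>S. if i \<in> T then F i else 0)"
        using fin by (intro sum.cong refl) simp
      also have "\<dots> = (if S = T then sum F S else 0)"
      proof (cases "S = T")
        case False
        then show ?thesis
          using disj[OF ST False] by (simp, intro sum.neutral) auto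
      qed simp
      finally show ?thesis .
    qed
    ultimately have FB: "sum F S ** B T \<in> span (B ` P)"
      using F_span by (simp only: span_diff span_scale span_zero split: if_split) simp
    have JB: "all_ones_mat ** B T = (sum s T * real CARD('x) - sum t T) *\<^sub>R all_ones_mat"
      using sumFJ[OF T] by (simp add: expand[OF T] matrix_mult_simps all_ones_mult_all_ones algebra_simps)
    have "B S ** B T = m *\<^sub>R (sum F S ** B T) - sum t S *\<^sub>R B T + sum s S *\<^sub>R (all_ones_mat ** B T)"
      unfolding expand[OF S] by (simp add: matrix_mult_simps)
    then show ?thesis
      using FB JB by (auto intro!: span_add span_diff span_scale B_span ST J_span)
  qed
  \<comment> \<open>Injectivity of \<open>B\<close> turns coefficients on the set of merged matrices
    into coefficients indexed by parts.\<close>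
  have "\<exists>c. B S ** B T = (\<Sum>U\<in>P. c U *\<^sub>R B U)" if ST: "S \<in> P" "T \<in> P" for S T
  proof -
    obtain u where "B S ** B T = (\<Sum>v\<in>B ` P. u v *\<^sub>R v)"
      using prod[OF ST] finP by (auto simp: span_finite)
    then have "B S ** B T = (\<Sum>U\<in>P. u (B U) *\<^sub>R B U)"
      using inj by (simp add: sum.reindex)
    then show ?thesis
      by (intro exI[of _ "\<lambda>U. u (B U)"])
  qed
  then have "\<exists>p. \<forall>S\<in>P. \<forall>T\<in>P. B S ** B T = (\<Sum>U\<in>P. p S T U *\<^sub>R B U)"
    by metis
  moreover have "zero_one_mat (B S)" if "S \<in> P" for S
    unfolding zero_one_mat_def B_def using scheme_sum_entry[OF sch sub[OF that]] by blast
  moreover have "transpose (B S) = B S" if "S \<in> P" for S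
    using sch sub[OF that] unfolding B_def transpose_simps
    by (intro sum.cong) (auto simp: symmetric_association_scheme_def)
  ultimately show "symmetric_association_scheme P {0} (\<lambda>S. \<Sum>l\<in>S. A l)"
    using P finP inj B0 sumB unfolding symmetric_association_scheme_def B_def by blast
qed

text \<open>Injectivity permits one zero matrix in a scheme. It contributes nothing to the total, so
  \<open>A e\<close> is still the complement of the relations in \<open>K\<close>.\<close>

lemma scheme_sum_nonzero:
  fixes A :: "nat \<Rightarrow> real^'x^'x::finite"
  assumes sch: "symmetric_association_scheme {0..d} 0 A" and e: "e \<in> {1..d}" "e \<notin> K" "K \<subseteq> {1..d}"
    and 0: "\<And>i. i \<in> {1..d} - insert e K \<Longrightarrow> A i = 0"
  shows "A e = all_ones_mat - mat 1 - sum A K"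
proof -
  have "all_ones_mat = sum A {0..d}"
    using sch by (simp add: symmetric_association_scheme_def)
  also have "\<dots> = sum A (insert 0 (insert e K))"
    using e 0 by (intro sum.mono_neutral_right) (auto simp: Suc_le_eq)
  also have "\<dots> = mat 1 + (A e + sum A K)"
    using e sch finite_subset[OF e(3)] by (subst sum.insert) (auto simp: symmetric_association_scheme_def)
  finally show ?thesis
    by (simp add: algebra_simps)
qed

text \<open>The projection \<open>E\<close> for \<open>e\<close> is what the others leave of the
  space orthogonal to the all-ones vector. Complementation gives \<open>A e\<close> the parameter
  \<open>m + 1 - T\<close> in place of \<open>t\<close>.\<close>

lemma amorphic_if_all_but_one_latin_like:
  fixes A :: "nat \<Rightarrow> real^'x^'x::finite"
  assumes sch: "symmetric_association_scheme {0..d} 0 A" and e: "e \<in> {1..d}" "e \<notin> K" "K \<subseteq> {1..d}"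
    and 0: "\<And>i. i \<in> {1..d} - insert e K \<Longrightarrow> A i = 0"
    and v: "m\<^sup>2 = real CARD('x)"
    and L: "\<And>i. i \<in> K \<Longrightarrow> latin_like m (u i) (A i)"
  shows "amorphic d A"
proof -
  have m: "m \<noteq> 0"
    using v by auto
  define G where "G i = latin_idem m (u i) (A i)" for i
  note idem = latin_like_idem[OF L, folded G_def]
  have fin: "finite K"
    using e(3) finite_subset by blast
  have orth: "G i ** G j = (if i = j then G i else 0)" if "i \<in> K" "j \<in> K" for i j
  proof (cases "i = j")
    case False
    have "i \<in> {0..d}" "j \<in> {0..d}"
      using that e(3) by auto
    then show ?thesis
      unfolding G_def
      using latin_idem_orthogonal[OF L[OF that(1)] L[OF that(2)]] scheme_commute[OF sch]
        scheme_trace_mult[OF sch _ _ False] False by auto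
  qed (use idem that in simp)
  define E where "E = mat 1 - (1/m\<^sup>2) *\<^sub>R all_ones_mat - sum G K"
  define F where "F i = (if i \<in> K then G i else if i = e then E else 0)" for i
  have sumJ: "sum G K ** all_ones_mat = 0" "all_ones_mat ** sum G K = 0"
    using idem by (simp_all add: matrix_mult.sum_left matrix_mult.sum_right)
  have Gsum: "G i ** sum G K = G i" "sum G K ** G i = G i" if "i \<in> K" for i
    using that fin orth by (simp_all add: matrix_mult.sum_left matrix_mult.sum_right)
  have "sum G K ** sum G K = sum G K"
    using Gsum by (simp add: matrix_mult.sum_left)
  then have EE: "E ** E = E"
    using m by (simp add: E_def matrix_mult_simps sumJ all_ones_mult_all_ones flip: v)
  have EJ: "E ** all_ones_mat = 0" "all_ones_mat ** E = 0"
    using m by (simp_all add: E_def matrix_mult_simps sumJ all_ones_mult_all_ones flip: v)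
  have EG: "E ** G i = 0" "G i ** E = 0" if "i \<in> K" for i
    using idem that Gsum by (simp_all add: E_def matrix_mult_simps)
  define T where "T = sum u K"
  have "sum A K = (\<Sum>i\<in>K. m *\<^sub>R G i - u i *\<^sub>R mat 1 + (u i / m) *\<^sub>R all_ones_mat)"
    unfolding G_def by (intro sum.cong refl latin_idem_expand[OF m])
  then have "A e = all_ones_mat - mat 1 - (\<Sum>i\<in>K. m *\<^sub>R G i - u i *\<^sub>R mat 1 + (u i / m) *\<^sub>R all_ones_mat)"
    using scheme_sum_nonzero[OF sch e 0] by simp
  also have "\<dots> = all_ones_mat - mat 1 - (m *\<^sub>R sum G K - T *\<^sub>R mat 1 + (T / m) *\<^sub>R all_ones_mat)"
    by (simp add: T_def sum.distrib sum_subtractf scaleR_sum_right scaleR_sum_left sum_divide_distrib)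
  also have "\<dots> = m *\<^sub>R E - (m + 1 - T) *\<^sub>R mat 1 + (1 + (1 - T) / m) *\<^sub>R all_ones_mat"
    using m by (simp add: E_def vec_eq_iff field_simps power2_eq_square)
  finally have Ae: "A e = m *\<^sub>R E - (m + 1 - T) *\<^sub>R mat 1 + (1 + (1 - T) / m) *\<^sub>R all_ones_mat" .
  show ?thesis
  proof (rule amorphic_if_orthogonal_idempotents[OF sch m])
    fix i assume i: "i \<in> {1..d}"
    show "A i = m *\<^sub>R F i - (if i \<in> K then u i else if i = e then m + 1 - T else 0) *\<^sub>R mat 1
        + (if i \<in> K then u i / m else if i = e then 1 + (1 - T) / m else 0) *\<^sub>R all_ones_mat"
      using Ae 0[of i] i latin_idem_expand[OF m, of "A i" "u i"] by (auto simp: F_def G_def)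
    show "F i ** all_ones_mat = 0 \<and> all_ones_mat ** F i = 0"
      using idem EJ by (auto simp: F_def matrix_mult_simps)
    fix j
    show "F i ** F j = (if i = j then F i else 0)"
      using orth EE EG e(2) by (auto simp: F_def matrix_mult_simps)
  qed
qed

section \<open>A common sign for all relations\<close>

lemma srg_type_imp_latin_like:
  fixes M :: "real^'x^'x::finite"
  assumes "srg_latin_square_type M \<or> srg_negative_latin_square_type M"
  obtains m t where "latin_like m t M" "t * m > 0"
    "m = sqrt (real CARD('x)) \<or> m = - sqrt (real CARD('x))"
proof -
  \<comment> \<open>Both types require \<open>n\<close> and \<open>s\<close> to be nonzero of equal
    sign; the sign of \<open>n\<close> tells them apart.\<close>
  obtain n s :: int where ns: "srg_with_type_params M n s" "s * n > 0"
    using assms by (auto simp: srg_latin_square_type_def srg_negative_latin_square_type_def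
        zero_less_mult_iff)
  note L = srg_with_type_params_latin_like[OF ns(1)]
  have "(real_of_int n)\<^sup>2 = (sqrt (real CARD('x)))\<^sup>2"
    using L by (simp add: latin_like_def)
  then have "real_of_int n = sqrt (real CARD('x)) \<or> real_of_int n = - sqrt (real CARD('x))"
    unfolding power2_eq_iff .
  moreover have "real_of_int s * real_of_int n > 0"
    using ns(2) by (simp flip: of_int_mult)
  ultimately show ?thesis
    using that L by blast
qed

text \<open>If both signs occur, one of them belongs to a single graph of conference type, and
  \<open>latin_like_switch\<close> moves that graph to the other sign.\<close>

lemma latin_like_common_sign:
  fixes A :: "nat \<Rightarrow> real^'x^'x::finite"
  assumes sch: "symmetric_association_scheme {0..d} 0 A" and e: "e \<in> {1..d}" "e \<notin> K" "K \<subseteq> {1..d}"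
    and 0: "\<And>i. i \<in> {1..d} - insert e K \<Longrightarrow> A i = 0" and Ae: "A e \<noteq> 0"
    and ty: "\<And>i. i \<in> K \<Longrightarrow> srg_latin_square_type (A i) \<or> srg_negative_latin_square_type (A i)"
  shows "\<exists>m u. m\<^sup>2 = real CARD('x) \<and> (\<forall>i\<in>K. latin_like m (u i) (A i))"
proof -
  define n where "n = sqrt (real CARD('x))"
  have n: "n\<^sup>2 = real CARD('x)" "n > 0"
    by (simp_all add: n_def)
  have "\<exists>m t. latin_like m t (A i) \<and> t * m > 0 \<and> (m = n \<or> m = - n)" if "i \<in> K" for i
    using srg_type_imp_latin_like[OF ty[OF that]] unfolding n_def by metis
  then obtain s t where st: "latin_like (s i) (t i) (A i)" "t i * s i > 0" "s i = n \<or> s i = - n"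
    if "i \<in> K" for i
    by metis
  have fin: "finite K"
    using e(3) finite_subset by blast
  have K0: "i \<in> {0..d}" if "i \<in> K" for i
    using that e(3) by auto
  define G H where "G = {i \<in> K. s i = n}" and "H = {i \<in> K. s i = - n}"
  have GH: "K = G \<union> H" "G \<inter> H = {}"
    using st(3) n(2) by (auto simp: G_def H_def)
  show ?thesis
  proof (cases "G = {} \<or> H = {}")
    case True
    then show ?thesis
    proof
      assume "G = {}"
      then have "s i = - n" if "i \<in> K" for i
        using that st(3)[OF that] \<open>G = {}\<close> unfolding G_def by blast
      then have "\<forall>i\<in>K. latin_like (- n) (t i) (A i)"
        using st(1) by metis
      then show ?thesis
        using n by (intro exI[of _ "- n"] exI[of _ t]) simp
    next
      assume "H = {}"
      then have "s i = n" if "i \<in> K" for i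
        using that st(3)[OF that] \<open>H = {}\<close> unfolding H_def by blast
      then have "\<forall>i\<in>K. latin_like n (t i) (A i)"
        using st(1) by metis
      then show ?thesis
        using n by (intro exI[of _ n] exI[of _ t]) simp
    qed
  next
    case False
    note sumA = scheme_sum_nonzero[OF sch e 0]
    have AJ: "A i ** all_ones_mat = (t i * (s i - 1)) *\<^sub>R all_ones_mat" if "i \<in> K" for i
      using st(1)[OF that] by (simp add: latin_like_def)
    \<comment> \<open>The entries of \<open>A e\<close> add up to \<open>n\<^sup>2\<close> times the
      difference of the two sides, and this total is positive because \<open>A e\<close> is a
      nonzero 0-1 matrix.\<close>
    have pos: "(\<Sum>i\<in>K. t i * (s i - 1)) < n\<^sup>2 - 1"
    proof -
      obtain x y where xy: "A e $ x $ y \<noteq> 0"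
        using Ae by (auto simp: vec_eq_iff)
      have nonneg: "0 \<le> A e $ a $ b" for a b
        using scheme_entry[OF sch, of e a b] e by auto
      have "A e $ x $ y \<le> (\<Sum>b\<in>UNIV. A e $ x $ b)"
        using nonneg by (intro member_le_sum) auto
      also have "\<dots> \<le> (\<Sum>a\<in>UNIV. \<Sum>b\<in>UNIV. A e $ a $ b)"
        using nonneg by (intro member_le_sum[of x UNIV "\<lambda>a. \<Sum>b\<in>UNIV. A e $ a $ b"] sum_nonneg) auto
      also have "\<dots> = trace (A e ** all_ones_mat)"
        by (simp add: trace_mult_symmetric)
      also have "\<dots> = trace ((all_ones_mat - mat 1 - sum A K) ** all_ones_mat)"
        using sumA by (simp only:)
      also have "\<dots> = n\<^sup>2 * (n\<^sup>2 - 1 - (\<Sum>i\<in>K. t i * (s i - 1)))"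
        by (simp add: matrix_mult_simps matrix_mult.sum_left trace_simps AJ trace_all_ones
            all_ones_mult_all_ones n(1) algebra_simps sum_distrib_left)
      finally have "0 < n\<^sup>2 * (n\<^sup>2 - 1 - (\<Sum>i\<in>K. t i * (s i - 1)))"
        using xy nonneg[of x y] by linarith
      then show ?thesis
        using n(2) by (simp add: zero_less_mult_iff)
    qed
    have conf: "(\<exists>i. G = {i} \<and> 2 * t i = n + 1) \<or> (\<exists>j. H = {j} \<and> 2 * t j = - n + 1)"
    proof (rule opposite_types_imp_conference[where A = A])
      show "finite G" "finite H" "G \<inter> H = {}" "G \<noteq> {}" "H \<noteq> {}"
        using fin GH False by auto
      show "latin_like n (t i) (A i) \<and> 0 < t i * n" if "i \<in> G" for i
        using st[of i] that by (auto simp: G_def)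
      show "latin_like (- n) (t i) (A i) \<and> 0 < t i * - n" if "i \<in> H" for i
        using st[of i] that by (auto simp: H_def)
      show "trace (A i ** A j) = 0" if "i \<in> G \<union> H" "j \<in> G \<union> H" "i \<noteq> j" for i j
        using scheme_trace_mult[OF sch] K0 that GH(1) by blast
      show "A i ** A j = A j ** A i" if "i \<in> G \<union> H" "j \<in> G \<union> H" for i j
        using scheme_commute[OF sch] K0 that GH(1) by blast
      show "A i ** A j \<in> span (insert (mat 1) (insert all_ones_mat (A ` (G \<union> H))))"
        if "i \<in> G \<union> H" "j \<in> G \<union> H" for i j
      proof -
        \<comment> \<open>\<open>A e\<close> and the zero relations lie in the span of
          \<open>?V\<close>, so the whole scheme does.\<close>
        let ?V = "insert (mat 1) (insert all_ones_mat (A ` K))"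
        have K: "A h \<in> span ?V" if "h \<in> K" for h
          using that by (intro span_base) auto
        have "A e \<in> span ?V"
          by (subst sumA) (auto intro!: span_diff span_sum K intro: span_base)
        moreover have "A 0 \<in> span ?V"
          using sch by (auto simp: symmetric_association_scheme_def intro: span_base)
        moreover have "A h = 0" if "h \<in> {0..d}" "h \<noteq> 0" "h \<noteq> e" "h \<notin> K" for h
          using that by (intro 0) auto
        ultimately have "A h \<in> span ?V" if "h \<in> {0..d}" for h
          using K that by (metis span_zero)
        then have "span (A ` {0..d}) \<subseteq> span ?V"
          by (intro span_minimal) auto
        then show ?thesis
          using scheme_mult_span[OF sch] K0 that unfolding GH(1)[symmetric] by blast
      qed
      have "(\<Sum>i\<in>K. t i * (s i - 1)) = (\<Sum>i\<in>G. t i * (s i - 1)) + (\<Sum>i\<in>H. t i * (s i - 1))"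
        using fin GH by (simp add: sum.union_disjoint)
      then show "(\<Sum>i\<in>G. t i * (n - 1)) + (\<Sum>i\<in>H. t i * (- n - 1)) < n\<^sup>2 - 1"
        using pos by (simp add: G_def H_def)
    qed
    then show ?thesis
    proof (elim disjE exE conjE)
      fix i assume i: "G = {i}" "2 * t i = n + 1"
      then have "i \<in> K" "s i = n"
        by (auto simp: G_def)
      then have "latin_like (- n) (t i - n) (A i)"
        using st(1)[of i] latin_like_switch[of n "t i" "A i"] i(2) by simp
      moreover have "latin_like (- n) (t l) (A l)" if "l \<in> K" "l \<noteq> i" for l
      proof -
        have "s l \<noteq> n"
          using that i(1) unfolding G_def by blast
        then show ?thesis
          using st(1,3)[OF that(1)] by auto
      qed
      ultimately have "\<forall>l\<in>K. latin_like (- n) (if l = i then t i - n else t l) (A l)"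
        by simp
      then show ?thesis
        using n by (intro exI[of _ "- n"] exI[of _ "\<lambda>l. if l = i then t i - n else t l"]) simp
    next
      fix j assume j: "H = {j}" "2 * t j = - n + 1"
      then have "j \<in> K" "s j = - n"
        by (auto simp: H_def)
      then have "latin_like n (t j + n) (A j)"
        using st(1)[of j] latin_like_switch[of "- n" "t j" "A j"] j(2) by simp
      moreover have "latin_like n (t l) (A l)" if "l \<in> K" "l \<noteq> j" for l
      proof -
        have "s l \<noteq> - n"
          using that j(1) unfolding H_def by blast
        then show ?thesis
          using st(1,3)[OF that(1)] by auto
      qed
      ultimately have "\<forall>l\<in>K. latin_like n (if l = j then t j + n else t l) (A l)"
        by simp
      then show ?thesis
        using n by (intro exI[of _ n] exI[of _ "\<lambda>l. if l = j then t j + n else t l"]) simp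
    qed
  qed
qed

theorem theorem4p1:
  fixes d :: nat and A :: "nat \<Rightarrow> real ^ 'x::finite ^ 'x"
  assumes "symmetric_association_scheme {0..d} 0 A"
    and "card {i \<in> {1..d}. \<not> srg_latin_square_type (A i) \<and>
                            \<not> srg_negative_latin_square_type (A i)} \<le> 1"
  shows "amorphic d A"
proof (cases "\<forall>i\<in>{1..d}. A i = 0")
  case True
  \<comment> \<open>No nonzero relation can serve as \<open>e\<close>; zero projections with
    \<open>m = 1\<close> suffice.\<close>
  then show ?thesis
    by (intro amorphic_if_orthogonal_idempotents[OF assms(1), of 1 "\<lambda>_. 0" "\<lambda>_. 0" "\<lambda>_. 0"])
      (auto simp: matrix_mult_simps)
next
  case False
  define Bad where "Bad = {i \<in> {1..d}. \<not> srg_latin_square_type (A i) \<and>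
                            \<not> srg_negative_latin_square_type (A i)}"
  have Bad: "i = j" if "i \<in> Bad" "j \<in> Bad" for i j
    using assms(2) that card_le_Suc0_iff_eq[of Bad] by (auto simp: Bad_def)
  \<comment> \<open>If the only relation of neither type is the zero matrix, or there is none, any
    nonzero relation is set aside as \<open>e\<close>. In every case \<open>A e\<close> is nonzero,
    as the comparison of signs requires.\<close>
  obtain e where e: "e \<in> {1..d}" "A e \<noteq> 0" and e_Bad: "\<And>i. i \<in> Bad \<Longrightarrow> A i \<noteq> 0 \<Longrightarrow> i = e"
  proof (cases "\<exists>i\<in>Bad. A i \<noteq> 0")
    case True
    then obtain e where "e \<in> Bad" "A e \<noteq> 0" by blast
    then show ?thesis
      by (intro that[of e] Bad) (auto simp: Bad_def)
  next
    case none: False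
    then show ?thesis
      using that False by blast
  qed
  define K where "K = {i \<in> {1..d}. A i \<noteq> 0} - {e}"
  have K: "e \<notin> K" "K \<subseteq> {1..d}" "\<And>i. i \<in> {1..d} - insert e K \<Longrightarrow> A i = 0"
    by (auto simp: K_def)
  have "srg_latin_square_type (A i) \<or> srg_negative_latin_square_type (A i)" if "i \<in> K" for i
    using e_Bad[of i] that by (auto simp: K_def Bad_def)
  then obtain m u where "m\<^sup>2 = real CARD('x)" "\<forall>i\<in>K. latin_like m (u i) (A i)"
    using latin_like_common_sign[OF assms(1) e(1) K e(2)] by blast
  then show ?thesis
    using amorphic_if_all_but_one_latin_like[OF assms(1) e(1) K] by blast
qed

end
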